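(* Let $\mathbf{k}$ be a commutative ring and $n\in\mathbb{N}$. The family $(a_w)_{w\in S_n}$ is a basis of the $\mathbf{k}$-module $\mathbf{k}[S_n]$.
   Context: $[m]=\{1,\ldots,m\}$ (empty if $m\le0$). $S_n$ is the group of permutations of $[n]$, with product $(\pi\sigma)(i)=\pi(\sigma(i))$; $\mathbf{k}[S_n]$ is its group algebra. For $i\in[n-1]$, $s_i\in S_n$ is the transposition swapping $i$ and $i+1$. For $w\in S_n$, $\operatorname{Des}w:=\{i\in[n-1]\mid w(i)>w(i+1)\}$. For $I\subseteq[n-1]$, $G(I)$ is the subgroup of $S_n$ generated by $\{s_i\mid i\in I\}$. For $w\in S_n$, $a_w:=\sum_{\sigma\in G(\operatorname{Des}w)}w\sigma\in\mathbf{k}[S_n]$. *)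

theory Defs
  imports "HOL-Algebra.Sym_Groups" "HOL-Algebra.Module"
begin

section \<open>Bases of modules\<close>

text \<open>
  These are notions for a \<^emph>\<open>family\<close> \<^term>\<open>b\<close> of vectors indexed by a set \<^term>\<open>I\<close>, rather than
  for the set of its members. In particular a family with repeated members is independent only
  over the zero ring.
\<close>

definition lin_indep_family ::
    "('k, 'r) ring_scheme \<Rightarrow> ('k, 'm, 'x) module_scheme \<Rightarrow> 'i set \<Rightarrow> ('i \<Rightarrow> 'm) \<Rightarrow> bool" where
  "lin_indep_family R M I b \<longleftrightarrow>
     (\<forall>J c. finite J \<and> J \<subseteq> I \<and> c \<in> J \<rightarrow> carrier R \<and>
        (\<Oplus>\<^bsub>M\<^esub>i\<in>J. c i \<odot>\<^bsub>M\<^esub> b i) = \<zero>\<^bsub>M\<^esub> \<longrightarrow> (\<forall>i\<in>J. c i = \<zero>\<^bsub>R\<^esub>))"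

definition spanning_family ::
    "('k, 'r) ring_scheme \<Rightarrow> ('k, 'm, 'x) module_scheme \<Rightarrow> 'i set \<Rightarrow> ('i \<Rightarrow> 'm) \<Rightarrow> bool" where
  "spanning_family R M I b \<longleftrightarrow>
     (\<forall>v\<in>carrier M. \<exists>J c. finite J \<and> J \<subseteq> I \<and> c \<in> J \<rightarrow> carrier R \<and>
        v = (\<Oplus>\<^bsub>M\<^esub>i\<in>J. c i \<odot>\<^bsub>M\<^esub> b i))"

definition module_basis ::
    "('k, 'r) ring_scheme \<Rightarrow> ('k, 'm, 'x) module_scheme \<Rightarrow> 'i set \<Rightarrow> ('i \<Rightarrow> 'm) \<Rightarrow> bool" where
  "module_basis R M I b \<longleftrightarrow>
     module R M \<and> b \<in> I \<rightarrow> carrier M \<and> lin_indep_family R M I b \<and> spanning_family R M I b"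


section \<open>Group algebras\<close>

definition supp_on :: "('k, 'r) ring_scheme \<Rightarrow> ('g, 'h) monoid_scheme \<Rightarrow> ('g \<Rightarrow> 'k) \<Rightarrow> 'g set" where
  "supp_on R G f = {x \<in> carrier G. f x \<noteq> \<zero>\<^bsub>R\<^esub>}"

text \<open>The group element \<^term>\<open>x\<close>, regarded as an element of the group algebra.\<close>

definition group_algebra_of ::
    "('k, 'r) ring_scheme \<Rightarrow> ('g, 'h) monoid_scheme \<Rightarrow> 'g \<Rightarrow> ('g \<Rightarrow> 'k)" where
  "group_algebra_of R G x = (\<lambda>y\<in>carrier G. if y = x then \<one>\<^bsub>R\<^esub> else \<zero>\<^bsub>R\<^esub>)"

text \<open>
  The element \<open>\<Sum>\<^sub>x f(x) x\<close> is represented by its coefficient function \<^term>\<open>f\<close>, of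
  finite support and extended by \<^term>\<open>undefined\<close> outside the group (so that equality of elements
  is equality of functions).
\<close>

definition group_algebra ::
    "('k, 'r) ring_scheme \<Rightarrow> ('g, 'h) monoid_scheme \<Rightarrow> ('k, 'g \<Rightarrow> 'k) module" where
  "group_algebra R G =
     \<lparr> carrier = {f \<in> carrier G \<rightarrow>\<^sub>E carrier R. finite (supp_on R G f)},
       monoid.mult = (\<lambda>f g. \<lambda>x\<in>carrier G.
         \<Oplus>\<^bsub>R\<^esub>p\<in>{(y, z). y \<in> supp_on R G f \<and> z \<in> supp_on R G g \<and> y \<otimes>\<^bsub>G\<^esub> z = x}.
           f (fst p) \<otimes>\<^bsub>R\<^esub> g (snd p)),
       one = group_algebra_of R G \<one>\<^bsub>G\<^esub>,
       zero = (\<lambda>x\<in>carrier G. \<zero>\<^bsub>R\<^esub>),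
       add = (\<lambda>f g. \<lambda>x\<in>carrier G. f x \<oplus>\<^bsub>R\<^esub> g x),
       smult = (\<lambda>c f. \<lambda>x\<in>carrier G. c \<otimes>\<^bsub>R\<^esub> f x) \<rparr>"

lemma abelian_group_group_algebra:
  assumes "cring R"
  shows "abelian_group (group_algebra R G)"
proof -
  interpret R: cring R by fact
  have fin: "finite (supp_on R G (\<lambda>x\<in>carrier G. f x \<oplus>\<^bsub>R\<^esub> g x))"
    if "finite (supp_on R G f)" "finite (supp_on R G g)" for f g
    by (rule finite_subset[OF _ finite_UnI[OF that]]) (auto simp: supp_on_def)
  show ?thesis
  proof (rule abelian_groupI, goal_cases)
    case (1 f g)
    then show ?case by (auto simp: group_algebra_def fin)
  next
    case 2
    show ?case by (auto simp: group_algebra_def supp_on_def)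
  next
    case (3 f g h)
    then show ?case
      by (intro ext) (auto simp: group_algebra_def R.a_assoc restrict_def PiE_iff)
  next
    case (4 f g)
    then show ?case
      by (intro ext) (auto simp: group_algebra_def R.a_comm restrict_def PiE_iff)
  next
    case (5 f)
    then show ?case
      by (intro ext) (auto simp: group_algebra_def restrict_def PiE_iff extensional_def)
  next
    case (6 f)
    let ?g = "\<lambda>x\<in>carrier G. \<ominus>\<^bsub>R\<^esub> f x"
    have "finite (supp_on R G ?g)"
      by (rule finite_subset[of _ "supp_on R G f"])
         (use 6 in \<open>auto simp: group_algebra_def supp_on_def\<close>)
    with 6 show ?case
      by (intro bexI[of _ ?g])
         (auto simp: group_algebra_def fun_eq_iff restrict_def PiE_iff extensional_def R.l_neg)
  qed
qed

lemma module_group_algebra: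
  assumes "cring R"
  shows "module R (group_algebra R G)"
proof -
  interpret R: cring R by fact
  show ?thesis
  proof (rule moduleI[OF assms abelian_group_group_algebra[OF assms]], goal_cases)
    case (1 a f)
    have "finite (supp_on R G (\<lambda>x\<in>carrier G. a \<otimes>\<^bsub>R\<^esub> f x))"
      by (rule finite_subset[of _ "supp_on R G f"])
         (use 1 in \<open>auto simp: group_algebra_def supp_on_def\<close>)
    with 1 show ?case by (auto simp: group_algebra_def)
  qed (auto simp: group_algebra_def fun_eq_iff restrict_def PiE_iff extensional_def
        R.l_distr R.r_distr R.m_assoc)
qed

lemma group_algebra_of_closed:
  assumes "cring R"
  shows "group_algebra_of R G x \<in> carrier (group_algebra R G)"
proof -
  interpret R: cring R by fact
  have "finite (supp_on R G (group_algebra_of R G x))"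
    by (rule finite_subset[of _ "{x}"])
       (auto simp: supp_on_def group_algebra_of_def split: if_splits)
  then show ?thesis by (auto simp: group_algebra_def group_algebra_of_def)
qed

text \<open>
  The product of the group algebra extends that of the group; this also covers the zero ring.
\<close>

lemma group_algebra_of_mult:
  assumes "cring R" "group G" "x \<in> carrier G" "y \<in> carrier G"
  shows "group_algebra_of R G x \<otimes>\<^bsub>group_algebra R G\<^esub> group_algebra_of R G y =
         group_algebra_of R G (x \<otimes>\<^bsub>G\<^esub> y)"
proof -
  interpret R: cring R by fact
  interpret G: group G by fact
  show ?thesis
  proof (cases "\<one>\<^bsub>R\<^esub> = \<zero>\<^bsub>R\<^esub>")
    case True
    then have "supp_on R G (group_algebra_of R G z) = {}" for z
      by (auto simp: supp_on_def group_algebra_of_def)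
    with True show ?thesis
      by (auto simp: group_algebra_def group_algebra_of_def fun_eq_iff)
  next
    case False
    have s: "supp_on R G (group_algebra_of R G z) = {z}" if "z \<in> carrier G" for z
      using False that by (auto simp: supp_on_def group_algebra_of_def split: if_splits)
    have set: "{(u, v). u = x \<and> v = y \<and> u \<otimes>\<^bsub>G\<^esub> v = z} =
        (if z = x \<otimes>\<^bsub>G\<^esub> y then {(x, y)} else {})" for z
      by auto
    show ?thesis
      using assms(3,4) by (intro ext) (auto simp: group_algebra_def s set, auto simp: group_algebra_of_def)
  qed
qed


section \<open>The elements \<open>a\<^sub>w\<close>\<close>

definition Des :: "nat \<Rightarrow> (nat \<Rightarrow> nat) \<Rightarrow> nat set" where
  "Des n w = {i \<in> {1..n - 1}. w i > w (i + 1)}"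

definition parabolic :: "nat \<Rightarrow> nat set \<Rightarrow> (nat \<Rightarrow> nat) set" where
  "parabolic n I = generate (sym_group n) ((\<lambda>i. transpose i (i + 1)) ` I)"

definition a_elt :: "('k, 'r) ring_scheme \<Rightarrow> nat \<Rightarrow> (nat \<Rightarrow> nat) \<Rightarrow> ((nat \<Rightarrow> nat) \<Rightarrow> 'k)" where
  "a_elt R n w =
     (\<Oplus>\<^bsub>group_algebra R (sym_group n)\<^esub>\<sigma>\<in>parabolic n (Des n w).
        group_algebra_of R (sym_group n) (w \<otimes>\<^bsub>sym_group n\<^esub> \<sigma>))"

end

theory Submission
  imports Defs "HOL-Library.Fun_Lexorder"
begin

text \<open>
  Order the permutations lexicographically by their one-line notation \<open>w(1) w(2) \<dots> w(n)\<close>.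
  The word of \<open>w\<close> falls into maximal decreasing runs, and multiplying \<open>w\<close> on the right by an
  element of \<open>G(Des w)\<close> permutes the letters within each run. A decreasing run is the
  lexicographically largest arrangement of its letters, so every \<open>w\<sigma>\<close> with
  \<open>\<sigma> \<in> G(Des w)\<close> and \<open>\<sigma> \<noteq> 1\<close> is strictly smaller than \<open>w\<close>
  (\<open>parabolic_Des_lex_less\<close>). Hence \<open>a\<^sub>w\<close> is \<open>w\<close>, with coefficient exactly 1, plus a combination
  of smaller permutations: the family is unitriangular with respect to the standard basis of
  the group algebra. Over any commutative ring such a family is a basis, by comparison of leading
  coefficients (\<open>unitriangular_lin_indep\<close>) and by elimination of leading terms
  (\<open>unitriangular_spanning\<close>).
\<close>

section \<open>Coefficients in the group algebra\<close>

lemma group_algebra_carrier_finite: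
  assumes "finite (carrier G)"
  shows "carrier (group_algebra R G) = carrier G \<rightarrow>\<^sub>E carrier R"
  using assms by (auto simp: group_algebra_def supp_on_def)

lemma group_algebra_finsum_apply:
  assumes "cring R" "f \<in> A \<rightarrow> carrier (group_algebra R G)" "x \<in> carrier G"
  shows "(\<Oplus>\<^bsub>group_algebra R G\<^esub>i\<in>A. f i) x = (\<Oplus>\<^bsub>R\<^esub>i\<in>A. f i x)"
proof -
  interpret R: cring R by fact
  interpret M: abelian_group "group_algebra R G"
    by (rule abelian_group_group_algebra[OF assms(1)])
  have zero: "\<zero>\<^bsub>group_algebra R G\<^esub> x = \<zero>\<^bsub>R\<^esub>"
    using assms(3) by (simp add: group_algebra_def)
  have add: "(f \<oplus>\<^bsub>group_algebra R G\<^esub> g) x = f x \<oplus>\<^bsub>R\<^esub> g x" for f g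
    using assms(3) by (simp add: group_algebra_def)
  have closed: "g x \<in> carrier R" if "g \<in> carrier (group_algebra R G)" for g
    using that assms(3) by (auto simp: group_algebra_def)
  show ?thesis
    using assms(2)
    by (induction A rule: infinite_finite_induct) (auto simp: zero add closed Pi_def)
qed

lemma group_algebra_lincomb_apply:
  assumes "cring R" "c \<in> J \<rightarrow> carrier R" "b \<in> J \<rightarrow> carrier (group_algebra R G)"
    "x \<in> carrier G"
  shows "(\<Oplus>\<^bsub>group_algebra R G\<^esub>i\<in>J. c i \<odot>\<^bsub>group_algebra R G\<^esub> b i) x =
    (\<Oplus>\<^bsub>R\<^esub>i\<in>J. c i \<otimes>\<^bsub>R\<^esub> b i x)"
proof -
  interpret M: module R "group_algebra R G" by (rule module_group_algebra[OF assms(1)])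
  have "(\<Oplus>\<^bsub>group_algebra R G\<^esub>i\<in>J. c i \<odot>\<^bsub>group_algebra R G\<^esub> b i) x =
      (\<Oplus>\<^bsub>R\<^esub>i\<in>J. (c i \<odot>\<^bsub>group_algebra R G\<^esub> b i) x)"
    using assms(2,3) by (intro group_algebra_finsum_apply[OF assms(1) _ assms(4)]) auto
  also have "(\<lambda>i. (c i \<odot>\<^bsub>group_algebra R G\<^esub> b i) x) = (\<lambda>i. c i \<otimes>\<^bsub>R\<^esub> b i x)"
    using assms(4) by (simp add: group_algebra_def)
  finally show ?thesis .
qed


section \<open>Unitriangular families are bases\<close>

text \<open>
  If some coefficient were nonzero, choose a maximal index \<open>m\<close> carrying one. The vectors \<open>b i\<close> with
  a nonzero entry at \<open>m\<close> are \<open>b m\<close> itself and some with \<open>m\<close> below \<open>i\<close>, and the latter have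
  coefficient zero; so the entry of the sum at \<open>m\<close> is the coefficient of \<open>b m\<close>.
\<close>

lemma unitriangular_lin_indep:
  assumes "cring R"
    and trans: "transp_on (carrier G) prec" and asym: "asymp_on (carrier G) prec"
    and closed: "b \<in> carrier G \<rightarrow> carrier (group_algebra R G)"
    and diag: "\<And>w. w \<in> carrier G \<Longrightarrow> b w w = \<one>\<^bsub>R\<^esub>"
    and tri: "\<And>w u. \<lbrakk>w \<in> carrier G; u \<in> carrier G; u \<noteq> w; \<not> prec u w\<rbrakk> \<Longrightarrow> b w u = \<zero>\<^bsub>R\<^esub>"
  shows "lin_indep_family R (group_algebra R G) (carrier G) b"
  unfolding lin_indep_family_def
proof (intro allI impI, elim conjE)
  fix J c
  assume fin: "finite J" and sub: "J \<subseteq> carrier G" and c: "c \<in> J \<rightarrow> carrier R"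
    and sum0: "(\<Oplus>\<^bsub>group_algebra R G\<^esub>i\<in>J. c i \<odot>\<^bsub>group_algebra R G\<^esub> b i)
      = \<zero>\<^bsub>group_algebra R G\<^esub>"
  interpret R: cring R by fact
  let ?S = "{i \<in> J. c i \<noteq> \<zero>\<^bsub>R\<^esub>}"
  have entry: "b i u \<in> carrier R" if "i \<in> carrier G" "u \<in> carrier G" for i u
    using closed that by (auto simp: group_algebra_def)
  show "\<forall>i\<in>J. c i = \<zero>\<^bsub>R\<^esub>"
  proof (rule ccontr)
    assume "\<not> ?thesis"
    then have ne: "?S \<noteq> {}" by auto
    have "\<exists>m\<in>?S. \<forall>x\<in>?S. x \<noteq> m \<longrightarrow> \<not> prec m x"
      using fin sub ne
      by (intro Finite_Set.bex_max_element)
        (auto intro: transp_on_subset[OF trans] asymp_on_subset[OF asym])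
    then obtain m where m: "m \<in> J" "c m \<noteq> \<zero>\<^bsub>R\<^esub>"
      and max: "\<And>x. \<lbrakk>x \<in> J; c x \<noteq> \<zero>\<^bsub>R\<^esub>; x \<noteq> m\<rbrakk> \<Longrightarrow> \<not> prec m x"
      by auto
    have mG: "m \<in> carrier G" using m sub by auto
    have "\<zero>\<^bsub>R\<^esub> = (\<Oplus>\<^bsub>group_algebra R G\<^esub>i\<in>J. c i \<odot>\<^bsub>group_algebra R G\<^esub> b i) m"
      using mG by (simp add: sum0) (simp add: group_algebra_def)
    also have "\<dots> = (\<Oplus>\<^bsub>R\<^esub>i\<in>J. c i \<otimes>\<^bsub>R\<^esub> b i m)"
      using c closed sub mG by (intro group_algebra_lincomb_apply assms(1)) auto
    also have "\<dots> = (\<Oplus>\<^bsub>R\<^esub>i\<in>J. if m = i then c i else \<zero>\<^bsub>R\<^esub>)"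
    proof (intro R.finsum_cong')
      fix i assume i: "i \<in> J"
      then have iG: "i \<in> carrier G" and ci: "c i \<in> carrier R" using sub c by auto
      show "c i \<otimes>\<^bsub>R\<^esub> b i m = (if m = i then c i else \<zero>\<^bsub>R\<^esub>)"
      proof (cases "m = i \<or> c i = \<zero>\<^bsub>R\<^esub>")
        case True
        then show ?thesis using iG mG ci by (auto simp: diag entry)
      next
        case False
        then have "b i m = \<zero>\<^bsub>R\<^esub>" using max[OF i] by (intro tri iG mG) auto
        then show ?thesis using False ci by auto
      qed
    qed (use c in auto)
    also have "\<dots> = c m"
      using R.finsum_singleton[OF m(1) fin c] by simp
    finally show False using m by simp
  qed
qed

text \<open>
  Elimination: a vector supported on a down-closed set \<open>D\<close> remains supported on \<open>D\<close> after
  subtraction of the multiple of \<open>b m\<close> that cancels its entry at a maximal element \<open>m\<close> of \<open>D\<close>,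
  and \<open>D - {m}\<close> is again down-closed.
\<close>

lemma unitriangular_span_down_closed:
  assumes "cring R" and finG: "finite (carrier G)"
    and trans: "transp_on (carrier G) prec" and asym: "asymp_on (carrier G) prec"
    and closed: "b \<in> carrier G \<rightarrow> carrier (group_algebra R G)"
    and diag: "\<And>w. w \<in> carrier G \<Longrightarrow> b w w = \<one>\<^bsub>R\<^esub>"
    and tri: "\<And>w u. \<lbrakk>w \<in> carrier G; u \<in> carrier G; u \<noteq> w; \<not> prec u w\<rbrakk> \<Longrightarrow> b w u = \<zero>\<^bsub>R\<^esub>"
    and "D \<subseteq> carrier G" and "\<And>x y. \<lbrakk>x \<in> D; y \<in> carrier G; prec y x\<rbrakk> \<Longrightarrow> y \<in> D"
    and "v \<in> carrier (group_algebra R G)" and "supp_on R G v \<subseteq> D"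
  shows "\<exists>c \<in> D \<rightarrow> carrier R.
    v = (\<Oplus>\<^bsub>group_algebra R G\<^esub>i\<in>D. c i \<odot>\<^bsub>group_algebra R G\<^esub> b i)"
proof -
  interpret R: cring R by fact
  interpret M: module R "group_algebra R G" by (rule module_group_algebra[OF assms(1)])
  have "finite D" using assms(8) finG finite_subset by blast
  then show ?thesis using assms(8-)
  proof (induction D arbitrary: v rule: finite_remove_induct)
    case empty
    then have "v = \<zero>\<^bsub>group_algebra R G\<^esub>"
      by (auto simp: group_algebra_def supp_on_def fun_eq_iff PiE_iff extensional_def)
    then show ?case by simp
  next
    case (remove D)
    have "\<exists>m\<in>D. \<forall>x\<in>D. x \<noteq> m \<longrightarrow> \<not> prec m x"
      using remove.hyps remove.prems(1)
      by (intro Finite_Set.bex_max_element)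
        (auto intro: transp_on_subset[OF trans] asymp_on_subset[OF asym])
    then obtain m where m: "m \<in> D" and max: "\<And>x. \<lbrakk>x \<in> D; x \<noteq> m\<rbrakk> \<Longrightarrow> \<not> prec m x" by auto
    have mG: "m \<in> carrier G" using m remove.prems by auto
    have bm: "b m \<in> carrier (group_algebra R G)" using closed mG by auto
    have vm: "v m \<in> carrier R" using remove.prems(3) mG by (auto simp: group_algebra_def)
    define v' where "v' = (\<lambda>x\<in>carrier G. v x \<ominus>\<^bsub>R\<^esub> v m \<otimes>\<^bsub>R\<^esub> b m x)"
    have ent: "v x \<in> carrier R" "b m x \<in> carrier R" if "x \<in> carrier G" for x
      using remove.prems(3) bm that by (auto simp: group_algebra_def)
    have v': "v' \<in> carrier (group_algebra R G)"
      using ent vm by (auto simp: group_algebra_carrier_finite[OF finG] v'_def)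
    have supp: "supp_on R G v' \<subseteq> D - {m}"
    proof
      fix x assume x: "x \<in> supp_on R G v'"
      then have xG: "x \<in> carrier G" and nz: "v x \<ominus>\<^bsub>R\<^esub> v m \<otimes>\<^bsub>R\<^esub> b m x \<noteq> \<zero>\<^bsub>R\<^esub>"
        by (auto simp: supp_on_def v'_def)
      have "x \<noteq> m" using nz vm mG by (auto simp: diag R.minus_eq R.r_neg)
      moreover have "x \<in> D"
      proof (rule ccontr)
        assume "x \<notin> D"
        then have "v x = \<zero>\<^bsub>R\<^esub>" using remove.prems(4) xG by (auto simp: supp_on_def)
        moreover have "b m x = \<zero>\<^bsub>R\<^esub>"
          using \<open>x \<notin> D\<close> \<open>x \<noteq> m\<close> remove.prems(2)[OF m xG] by (intro tri mG xG) auto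
        ultimately show False using nz vm by (simp add: R.minus_eq)
      qed
      ultimately show "x \<in> D - {m}" by simp
    qed
    have "\<exists>c \<in> D - {m} \<rightarrow> carrier R.
        v' = (\<Oplus>\<^bsub>group_algebra R G\<^esub>i\<in>D - {m}. c i \<odot>\<^bsub>group_algebra R G\<^esub> b i)"
      using remove.prems(1,2) max
      by (intro remove.IH[OF m] v' supp) auto
    then obtain c where c: "c \<in> D - {m} \<rightarrow> carrier R"
      and v'c: "v' = (\<Oplus>\<^bsub>group_algebra R G\<^esub>i\<in>D - {m}. c i \<odot>\<^bsub>group_algebra R G\<^esub> b i)"
      by auto
    let ?c = "c(m := v m)"
    have b: "b i \<in> carrier (group_algebra R G)" if "i \<in> D" for i
      using closed remove.prems(1) that by auto
    have c_closed: "c i \<in> carrier R" if "i \<in> D" "i \<noteq> m" for i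
      using c that by auto
    have "(\<Oplus>\<^bsub>group_algebra R G\<^esub>i\<in>insert m (D - {m}). ?c i \<odot>\<^bsub>group_algebra R G\<^esub> b i) =
        ?c m \<odot>\<^bsub>group_algebra R G\<^esub> b m \<oplus>\<^bsub>group_algebra R G\<^esub>
        (\<Oplus>\<^bsub>group_algebra R G\<^esub>i\<in>D - {m}. ?c i \<odot>\<^bsub>group_algebra R G\<^esub> b i)"
      using remove.hyps c_closed vm b m by (intro M.finsum_insert) auto
    also have "(\<Oplus>\<^bsub>group_algebra R G\<^esub>i\<in>D - {m}. ?c i \<odot>\<^bsub>group_algebra R G\<^esub> b i) = v'"
      unfolding v'c using c_closed b by (intro M.finsum_cong') auto
    also have "?c m \<odot>\<^bsub>group_algebra R G\<^esub> b m \<oplus>\<^bsub>group_algebra R G\<^esub> v' = v"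
    proof
      fix x
      show "(?c m \<odot>\<^bsub>group_algebra R G\<^esub> b m \<oplus>\<^bsub>group_algebra R G\<^esub> v') x = v x"
      proof (cases "x \<in> carrier G")
        case True
        then have "v m \<otimes>\<^bsub>R\<^esub> b m x \<oplus>\<^bsub>R\<^esub> (v x \<ominus>\<^bsub>R\<^esub> v m \<otimes>\<^bsub>R\<^esub> b m x) = v x"
          using ent[OF True] vm by algebra
        then show ?thesis using True by (simp add: group_algebra_def v'_def)
      next
        case False
        then show ?thesis
          using remove.prems(3) by (auto simp: group_algebra_def PiE_iff extensional_def)
      qed
    qed
    finally have "v = (\<Oplus>\<^bsub>group_algebra R G\<^esub>i\<in>D. ?c i \<odot>\<^bsub>group_algebra R G\<^esub> b i)"
      using m by (simp add: insert_absorb)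
    moreover have "?c \<in> D \<rightarrow> carrier R" using c vm by auto
    ultimately show ?case by blast
  qed
qed

lemma unitriangular_spanning:
  assumes "cring R" and finG: "finite (carrier G)"
    and "transp_on (carrier G) prec" and "asymp_on (carrier G) prec"
    and "b \<in> carrier G \<rightarrow> carrier (group_algebra R G)"
    and "\<And>w. w \<in> carrier G \<Longrightarrow> b w w = \<one>\<^bsub>R\<^esub>"
    and "\<And>w u. \<lbrakk>w \<in> carrier G; u \<in> carrier G; u \<noteq> w; \<not> prec u w\<rbrakk> \<Longrightarrow> b w u = \<zero>\<^bsub>R\<^esub>"
  shows "spanning_family R (group_algebra R G) (carrier G) b"
  unfolding spanning_family_def
proof
  fix v assume v: "v \<in> carrier (group_algebra R G)"
  have "supp_on R G v \<subseteq> carrier G" by (auto simp: supp_on_def)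
  then have "\<exists>c \<in> carrier G \<rightarrow> carrier R.
      v = (\<Oplus>\<^bsub>group_algebra R G\<^esub>i\<in>carrier G. c i \<odot>\<^bsub>group_algebra R G\<^esub> b i)"
    using v by (intro unitriangular_span_down_closed[OF assms]) auto
  then show "\<exists>J c. finite J \<and> J \<subseteq> carrier G \<and> c \<in> J \<rightarrow> carrier R \<and>
      v = (\<Oplus>\<^bsub>group_algebra R G\<^esub>i\<in>J. c i \<odot>\<^bsub>group_algebra R G\<^esub> b i)"
    using finG by blast
qed


section \<open>Parabolic subgroups and the lexicographic order\<close>

lemma finite_carrier_sym_group: "finite (carrier (sym_group n))"
  using finite_permutations[of "{1..n}"] by (simp add: sym_group_def)

lemma transpose_in_sym_group:
  assumes "i \<in> {1..n - 1}"
  shows "transpose i (i + 1) \<in> carrier (sym_group n)"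
  unfolding sym_group_carrier using assms by (intro permutes_swap_id) auto

lemma parabolic_subset:
  assumes "I \<subseteq> {1..n - 1}"
  shows "parabolic n I \<subseteq> carrier (sym_group n)"
  unfolding parabolic_def
  using assms transpose_in_sym_group by (intro group.generate_incl[OF sym_group_is_group]) blast

lemma id_in_parabolic: "id \<in> parabolic n I"
  unfolding parabolic_def using generate.one[of "sym_group n"] by (simp add: sym_group_one)

lemma sym_group_inv_eq:
  assumes "p \<in> carrier (sym_group n)"
  shows "inv\<^bsub>sym_group n\<^esub> p = inv' p"
  using assms
  by (intro group.inv_equality[OF sym_group_is_group])
    (auto simp: sym_group_carrier sym_group_mult sym_group_one permutes_inv permutes_inv_o)

text \<open>
  Each generator \<open>s\<^sub>i\<close> with \<open>i \<noteq> k\<close> moves letters only within one side of the cut between \<open>k\<close> and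
  \<open>k + 1\<close>, so it lies in the stabiliser of the initial segment up to \<open>k\<close>.
\<close>

lemma parabolic_stabilizes_atMost:
  assumes "I \<subseteq> {1..n - 1}" and "k \<notin> I" and "p \<in> parabolic n I"
  shows "p ` {..k} = {..k}"
proof -
  let ?H = "{p \<in> carrier (sym_group n). p ` {..k} = {..k}}"
  have "subgroup ?H (sym_group n)"
  proof (rule group.subgroupI[OF sym_group_is_group])
    show "?H \<noteq> {}"
      by (auto simp: sym_group_carrier intro!: exI[of _ id] permutes_id)
  next
    fix p assume p: "p \<in> ?H"
    then have perm: "p permutes {1..n}" by (simp add: sym_group_carrier)
    have "inv' p ` {..k} = inv' p ` (p ` {..k})" using p by simp
    also have "\<dots> = {..k}" using permutes_inv_o(2)[OF perm] by (simp add: image_comp)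
    finally show "inv\<^bsub>sym_group n\<^esub> p \<in> ?H"
      using p perm by (simp add: sym_group_inv_eq sym_group_carrier permutes_inv)
  next
    fix p q assume pq: "p \<in> ?H" "q \<in> ?H"
    then have "(p \<circ> q) ` {..k} = {..k}" by (simp only: image_comp[symmetric] mem_Collect_eq)
    with pq show "p \<otimes>\<^bsub>sym_group n\<^esub> q \<in> ?H"
      by (simp add: sym_group_carrier sym_group_mult permutes_compose)
  qed auto
  moreover have "(\<lambda>i. transpose i (i + 1)) ` I \<subseteq> ?H"
  proof clarify
    fix i assume i: "i \<in> I"
    then have "i \<noteq> k" using assms(2) by auto
    then have "i \<in> {..k} \<longleftrightarrow> i + 1 \<in> {..k}" by auto
    then have "transpose i (i + 1) ` {..k} = {..k}" by (rule transpose_image_eq)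
    then show "transpose i (i + 1) \<in> carrier (sym_group n) \<and> transpose i (i + 1) ` {..k} = {..k}"
      using transpose_in_sym_group i assms(1) by auto
  qed
  ultimately have "parabolic n I \<subseteq> ?H"
    unfolding parabolic_def by (intro group.generate_subgroup_incl[OF sym_group_is_group])
  then show ?thesis using assms(3) by auto
qed

text \<open>
  Let \<open>i\<close> be the first position moved by \<open>\<sigma>\<close>. Then \<open>\<sigma>\<close> sends \<open>i\<close> to a later position, and since
  \<open>\<sigma>\<close> crosses no cut outside \<open>Des w\<close>, all positions in between are descents of \<open>w\<close>. So the word of
  \<open>w\<sigma>\<close> first differs from that of \<open>w\<close> at \<open>i\<close>, and it has a smaller letter there.
\<close>

lemma parabolic_Des_lex_less:
  assumes "\<sigma> \<in> parabolic n (Des n w)" and "\<sigma> \<noteq> id"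
  shows "less_fun (w \<circ> \<sigma>) w"
proof -
  have Des: "Des n w \<subseteq> {1..n - 1}" by (auto simp: Des_def)
  have perm: "\<sigma> permutes {1..n}"
    using parabolic_subset[OF Des] assms(1) by (auto simp: sym_group_carrier)
  have "\<exists>i. \<sigma> i \<noteq> i" using assms(2) by (auto simp: fun_eq_iff)
  then obtain i where i: "\<sigma> i \<noteq> i" and fixed: "\<And>k. k < i \<Longrightarrow> \<sigma> k = k"
    using exists_least_iff[of "\<lambda>i. \<sigma> i \<noteq> i"] by auto
  have "i < \<sigma> i"
  proof (rule ccontr)
    assume "\<not> i < \<sigma> i"
    then have "\<sigma> i < i" using i by simp
    then have "\<sigma> (\<sigma> i) = \<sigma> i" by (rule fixed)
    then show False using permutes_inj[OF perm] i by (auto dest: injD)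
  qed
  have descent: "w (Suc k) < w k" if "i \<le> k" "k < \<sigma> i" for k
  proof -
    have "k \<in> Des n w"
    proof (rule ccontr)
      assume "k \<notin> Des n w"
      then have "\<sigma> ` {..k} = {..k}" using assms(1) by (rule parabolic_stabilizes_atMost[OF Des])
      then have "\<sigma> i \<in> {..k}" using that(1) by blast
      then show False using that(2) by simp
    qed
    then show ?thesis by (auto simp: Des_def)
  qed
  \<comment> \<open>The descents chain up along the whole stretch from \<open>i\<close> to \<open>\<sigma> i\<close>.\<close>
  have "w j < w i" if "i < j" "j \<le> \<sigma> i" for j
    using that
  proof (induction j)
    case (Suc j)
    then show ?case using descent[of j] by (cases "i = j") auto
  qed simp
  then have "w (\<sigma> i) < w i" using \<open>i < \<sigma> i\<close> by simp
  then show ?thesis using fixed by (auto intro!: less_funI exI[of _ i])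
qed


section \<open>Unitriangularity of the elements \<open>a\<^sub>w\<close>\<close>

lemma a_elt_summand_closed:
  assumes "cring R"
  shows "(\<lambda>\<sigma>. group_algebra_of R (sym_group n) (w \<otimes>\<^bsub>sym_group n\<^esub> \<sigma>))
    \<in> A \<rightarrow> carrier (group_algebra R (sym_group n))"
  by (intro Pi_I group_algebra_of_closed[OF assms])

lemma a_elt_closed:
  assumes "cring R"
  shows "a_elt R n w \<in> carrier (group_algebra R (sym_group n))"
proof -
  interpret M: abelian_group "group_algebra R (sym_group n)"
    by (rule abelian_group_group_algebra[OF assms])
  show ?thesis
    unfolding a_elt_def by (rule M.finsum_closed[OF a_elt_summand_closed[OF assms]])
qed

lemma a_elt_apply:
  assumes "cring R" "u \<in> carrier (sym_group n)"
  shows "a_elt R n w u =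
    (\<Oplus>\<^bsub>R\<^esub>\<sigma>\<in>parabolic n (Des n w). if u = w \<circ> \<sigma> then \<one>\<^bsub>R\<^esub> else \<zero>\<^bsub>R\<^esub>)"
  unfolding a_elt_def
    group_algebra_finsum_apply[OF assms(1) a_elt_summand_closed[OF assms(1)] assms(2)]
  using assms(2) by (simp add: group_algebra_of_def sym_group_mult)

text \<open>
  The coefficient counts the \<open>\<sigma>\<close> with \<open>w\<sigma> = w\<close>, and there is just one of them. That it is 1, and
  not merely nonzero, is what makes the basis property hold in every characteristic.
\<close>

lemma a_elt_leading_coeff:
  assumes "cring R" and w: "w \<in> carrier (sym_group n)"
  shows "a_elt R n w w = \<one>\<^bsub>R\<^esub>"
proof -
  interpret R: cring R by fact
  have sub: "parabolic n (Des n w) \<subseteq> carrier (sym_group n)"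
    by (rule parabolic_subset) (auto simp: Des_def)
  have eq: "w = w \<circ> \<sigma> \<longleftrightarrow> id = \<sigma>" if "\<sigma> \<in> parabolic n (Des n w)" for \<sigma>
    using parabolic_Des_lex_less[OF that] less_fun_irrefl[of w] by fastforce
  have "a_elt R n w w =
      (\<Oplus>\<^bsub>R\<^esub>\<sigma>\<in>parabolic n (Des n w). if id = \<sigma> then \<one>\<^bsub>R\<^esub> else \<zero>\<^bsub>R\<^esub>)"
    unfolding a_elt_apply[OF assms] by (intro R.finsum_cong') (auto simp: eq)
  also have "\<dots> = \<one>\<^bsub>R\<^esub>"
    using finite_subset[OF sub finite_carrier_sym_group]
    by (intro R.finsum_singleton id_in_parabolic) auto
  finally show ?thesis .
qed

lemma a_elt_lower_triangular:
  assumes "cring R" "u \<in> carrier (sym_group n)" "u \<noteq> w" "\<not> less_fun u w"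
  shows "a_elt R n w u = \<zero>\<^bsub>R\<^esub>"
proof -
  interpret R: cring R by fact
  have "u \<noteq> w \<circ> \<sigma>" if "\<sigma> \<in> parabolic n (Des n w)" for \<sigma>
    using parabolic_Des_lex_less[OF that] assms(3,4) by (cases "\<sigma> = id") auto
  then have "a_elt R n w u = (\<Oplus>\<^bsub>R\<^esub>\<sigma>\<in>parabolic n (Des n w). \<zero>\<^bsub>R\<^esub>)"
    unfolding a_elt_apply[OF assms(1,2)] by (intro R.finsum_cong') auto
  then show ?thesis by simp
qed

theorem proposition9p6:
  fixes R :: "('k, 'r) ring_scheme" and n :: nat
  assumes "cring R"
  shows "module_basis R (group_algebra R (sym_group n)) (carrier (sym_group n)) (a_elt R n)"
proof -
  have trans: "transp_on (carrier (sym_group n)) less_fun"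
    by (auto intro: transp_onI less_fun_trans)
  have asym: "asymp_on (carrier (sym_group n)) less_fun"
    by (auto intro: asymp_onI dest: less_fun_asym)
  have closed: "a_elt R n \<in> carrier (sym_group n) \<rightarrow> carrier (group_algebra R (sym_group n))"
    using a_elt_closed[OF assms] by blast
  show ?thesis
    unfolding module_basis_def
    using module_group_algebra[OF assms] closed
      unitriangular_lin_indep[OF assms trans asym closed]
      unitriangular_spanning[OF assms finite_carrier_sym_group trans asym closed]
      a_elt_leading_coeff[OF assms] a_elt_lower_triangular[OF assms]
    by blast
qed

end
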